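(* For each even integer $m\geq 4$, there exists a $2$-$(m^2,m+2,\lambda)$ design (for some positive integer $\lambda$) admitting $\mathrm{Sym}(m)\wr\mathrm{Sym}(2)$ as a flag-transitive, point-primitive group of automorphisms.
   Context: A $2$-$(v,k,\lambda)$ design ($v,k,\lambda$ positive integers) is a pair $(\mathcal{P},\mathcal{B})$ where $\mathcal{P}$ is a set of $v$ points and $\mathcal{B}$ is a set of $k$-element subsets of $\mathcal{P}$ (blocks) such that every $2$-element subset of $\mathcal{P}$ lies in exactly $\lambda$ blocks. A group of automorphisms is a permutation group on $\mathcal{P}$ preserving $\mathcal{B}$; it is flag-transitive if it is transitive on the set of flags (pairs $(p,B)$ with $p\in B\in\mathcal{B}$), and point-primitive if it acts primitively on $\mathcal{P}$. $\mathrm{Sym}(m)$ denotes the symmetric group of degree $m$, and $\mathrm{Sym}(m)\wr\mathrm{Sym}(2)=(\mathrm{Sym}(m)\times \mathrm{Sym}(m))\rtimes \mathrm{Sym}(2)$. *)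

theory Defs
  imports "HOL-Algebra.Sym_Groups" "HOL-Algebra.Bij" "HOL-Library.Disjoint_Sets"
begin

definition two_design :: "'a set \<Rightarrow> 'a set set \<Rightarrow> nat \<Rightarrow> nat \<Rightarrow> nat \<Rightarrow> bool" where
  "two_design P B v k l \<longleftrightarrow>
     0 < v \<and> 0 < k \<and> 0 < l \<and> finite P \<and> card P = v \<and>
     (\<forall>b\<in>B. b \<subseteq> P \<and> card b = k) \<and>
     (\<forall>S. S \<subseteq> P \<and> card S = 2 \<longrightarrow> card {b \<in> B. S \<subseteq> b} = l)"

definition automorphism_group_of :: "('a \<Rightarrow> 'a) set \<Rightarrow> 'a set \<Rightarrow> 'a set set \<Rightarrow> bool" where
  "automorphism_group_of G P B \<longleftrightarrow>
     subgroup G (BijGroup P) \<and> (\<forall>g\<in>G. (\<lambda>b. g ` b) ` B = B)"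

definition flags :: "'a set set \<Rightarrow> ('a \<times> 'a set) set" where
  "flags B = {(p, b). b \<in> B \<and> p \<in> b}"

definition flag_transitive :: "('a \<Rightarrow> 'a) set \<Rightarrow> 'a set set \<Rightarrow> bool" where
  "flag_transitive G B \<longleftrightarrow>
     (\<forall>(p, b)\<in>flags B. \<forall>(q, c)\<in>flags B. \<exists>g\<in>G. g p = q \<and> g ` b = c)"

definition transitive_on :: "('a \<Rightarrow> 'a) set \<Rightarrow> 'a set \<Rightarrow> bool" where
  "transitive_on G P \<longleftrightarrow> (\<forall>x\<in>P. \<forall>y\<in>P. \<exists>g\<in>G. g x = y)"

definition primitive_on :: "('a \<Rightarrow> 'a) set \<Rightarrow> 'a set \<Rightarrow> bool" where
  "primitive_on G P \<longleftrightarrow>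
     transitive_on G P \<and>
     (\<forall>Q. partition_on P Q \<and> (\<forall>g\<in>G. \<forall>D\<in>Q. g ` D \<in> Q) \<longrightarrow>
        Q = {P} \<or> Q = (\<lambda>x. {x}) ` P)"

definition semidirect_prod ::
  "('a, 'c) monoid_scheme \<Rightarrow> ('b, 'd) monoid_scheme \<Rightarrow> ('b \<Rightarrow> 'a \<Rightarrow> 'a) \<Rightarrow> ('a \<times> 'b) monoid" where
  "semidirect_prod N H \<phi> =
     \<lparr>carrier = carrier N \<times> carrier H,
      mult = (\<lambda>(n, h) (n', h'). (n \<otimes>\<^bsub>N\<^esub> \<phi> h n', h \<otimes>\<^bsub>H\<^esub> h')),
      one = (\<one>\<^bsub>N\<^esub>, \<one>\<^bsub>H\<^esub>)\<rparr>"

text \<open>\<open>Sym(m) \<wr> Sym(2)\<close> as an abstract group: the non-identity element of \<open>Sym(2)\<close>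
  swaps the two factors of the base group.\<close>

definition sym_wr_sym2 :: "nat \<Rightarrow> (((nat \<Rightarrow> nat) \<times> (nat \<Rightarrow> nat)) \<times> (nat \<Rightarrow> nat)) monoid" where
  "sym_wr_sym2 m =
     semidirect_prod (sym_group m \<times>\<times> sym_group m) (sym_group 2)
       (\<lambda>s (x, y). if s = id then (x, y) else (y, x))"

end

theory Submission
  imports Defs
begin

text \<open>Regard the points \<open>(i, j)\<close> as the edges of \<open>K\<^bsub>m,m\<^esub>\<close> and take as blocks the cycles of
  length \<open>m + 2\<close>, that is, the images of one such cycle under the group. The group has only two
  orbits on pairs of distinct points, the pairs of adjacent and of disjoint edges. In a cycle every
  edge is adjacent to \<open>2\<close> others and disjoint from \<open>m - 1\<close> others, in \<open>K\<^bsub>m,m\<^esub>\<close> to \<open>2(m - 1)\<close> and from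
  \<open>(m - 1)\<^sup>2\<close>; the ratios agree, so double counting puts pairs of both kinds in equally many blocks.
  Flag-transitivity holds because the rotations of the cycle, including those that exchange the two
  sides of \<open>K\<^bsub>m,m\<^esub>\<close>, are induced by the group.\<close>

text \<open>Indices run from \<open>1\<close>; without this, simp would turn \<open>1\<close> into
  \<open>Suc 0\<close> and facts stated with \<open>1\<close> would no longer match.\<close>

declare One_nat_def [simp del]

section \<open>Block orbits of permutation groups\<close>

lemma subgroup_BijGroup_bij_betw:
  assumes "subgroup G (BijGroup P)" "g \<in> G"
  shows "bij_betw g P P"
  using subgroup.mem_carrier[OF assms] by (simp add: BijGroup_def Bij_def)

lemma subgroup_BijGroup_compose:
  assumes "subgroup G (BijGroup P)" "g \<in> G" "h \<in> G"
  shows "compose P g h \<in> G"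
proof -
  have "g \<in> Bij P" "h \<in> Bij P"
    using subgroup.mem_carrier[OF assms(1)] assms by (auto simp: BijGroup_def)
  then show ?thesis
    using subgroup.m_closed[OF assms] by (simp add: BijGroup_def)
qed

text \<open>Elements of \<open>BijGroup P\<close> are \<open>undefined\<close> outside
  \<open>P\<close>, so the inverse laws are recorded pointwise on \<open>P\<close>.\<close>

lemma subgroup_BijGroup_inverse:
  assumes "subgroup G (BijGroup P)" "g \<in> G"
  obtains g' where "g' \<in> G" "\<And>x. x \<in> P \<Longrightarrow> g' (g x) = x" "\<And>x. x \<in> P \<Longrightarrow> g (g' x) = x"
proof -
  have g: "g \<in> Bij P"
    using subgroup.mem_carrier[OF assms] by (simp add: BijGroup_def)
  have "(\<lambda>x\<in>P. inv_into P g x) \<in> G"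
    using subgroup.m_inv_closed[OF assms] inv_BijGroup[OF g] by simp
  moreover have "bij_betw g P P"
    using g by (simp add: Bij_def)
  ultimately show thesis
    by (intro that) (auto simp: bij_betw_inv_into_left bij_betw_inv_into_right bij_betw_apply)
qed

lemma compose_image: "S \<subseteq> P \<Longrightarrow> compose P g h ` S = g ` h ` S"
  by (auto simp: compose_def image_iff subset_iff)

lemma orbit_block_subset:
  assumes "subgroup G (BijGroup P)" "B0 \<subseteq> P" "b \<in> (\<lambda>g. g ` B0) ` G"
  shows "b \<subseteq> P"
  using assms subgroup_BijGroup_bij_betw[OF assms(1)] bij_betw_imp_surj_on by blast

lemma orbit_block_image:
  assumes "subgroup G (BijGroup P)" "B0 \<subseteq> P" "b \<in> (\<lambda>g. g ` B0) ` G" "g \<in> G"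
  shows "g ` b \<in> (\<lambda>g. g ` B0) ` G"
proof -
  obtain h where h: "h \<in> G" "b = h ` B0" using assms(3) by auto
  have "g ` b = compose P g h ` B0" using compose_image assms(2) h by metis
  then show ?thesis using subgroup_BijGroup_compose[OF assms(1,4) h(1)] by blast
qed

text \<open>Each \<open>g\<close> maps the orbit of \<open>B0\<close> into itself; it maps onto it
  because a block \<open>b\<close> is the image under \<open>g\<close> of the block obtained from
  \<open>b\<close> by the inverse of \<open>g\<close>.\<close>

lemma automorphism_group_of_block_orbit:
  assumes G: "subgroup G (BijGroup P)" and B0: "B0 \<subseteq> P"
  shows "automorphism_group_of G P ((\<lambda>g. g ` B0) ` G)"
proof -
  let ?B = "(\<lambda>g. g ` B0) ` G"
  have "(\<lambda>b. g ` b) ` ?B = ?B" if g: "g \<in> G" for g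
  proof
    show "(\<lambda>b. g ` b) ` ?B \<subseteq> ?B"
      using orbit_block_image[OF G B0 _ g] by blast
    show "?B \<subseteq> (\<lambda>b. g ` b) ` ?B"
    proof
      fix b assume b: "b \<in> ?B"
      obtain g' where g': "g' \<in> G" "\<And>x. x \<in> P \<Longrightarrow> g (g' x) = x"
        using subgroup_BijGroup_inverse[OF G g] by metis
      have "g ` g' ` b = b"
        using orbit_block_subset[OF G B0 b] g'(2) by (force simp: image_iff)
      moreover have "g' ` b \<in> ?B" by (rule orbit_block_image[OF G B0 b g'(1)])
      ultimately show "b \<in> (\<lambda>b. g ` b) ` ?B" by (metis imageI)
    qed
  qed
  then show ?thesis using G by (simp add: automorphism_group_of_def)
qed

text \<open>It suffices that the stabiliser of \<open>B0\<close> is transitive on \<open>B0\<close>: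
  then every flag is an image of the base flag \<open>(p0, B0)\<close>, and two flags are linked
  through it.\<close>

lemma flag_transitive_block_orbit:
  assumes G: "subgroup G (BijGroup P)" and B0: "B0 \<subseteq> P" and p0: "p0 \<in> B0"
    and tr: "\<And>q. q \<in> B0 \<Longrightarrow> \<exists>g\<in>G. g p0 = q \<and> g ` B0 = B0"
  shows "flag_transitive G ((\<lambda>g. g ` B0) ` G)"
proof -
  \<comment> \<open>Pull \<open>p\<close> back to a point \<open>p1\<close> of \<open>B0\<close>,
    move \<open>p0\<close> to \<open>p1\<close> inside the stabiliser of \<open>B0\<close>, then
    apply \<open>h\<close>.\<close>
  have base: "\<exists>f\<in>G. p = f p0 \<and> b = f ` B0"
    if pb: "b \<in> (\<lambda>g. g ` B0) ` G" "p \<in> b" for p b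
  proof -
    obtain h p1 where h: "h \<in> G" "b = h ` B0" "p = h p1" "p1 \<in> B0" using pb by auto
    obtain g where g: "g \<in> G" "g p0 = p1" "g ` B0 = B0" using tr[OF h(4)] by auto
    have "compose P h g p0 = p" using g h p0 B0 by (auto simp: compose_def)
    moreover have "compose P h g ` B0 = b" using g h compose_image[OF B0] by metis
    ultimately show ?thesis using subgroup_BijGroup_compose[OF G h(1) g(1)] by metis
  qed
  have "\<exists>g\<in>G. g p = q \<and> g ` b = c"
    if pb: "b \<in> (\<lambda>g. g ` B0) ` G" "p \<in> b" and qc: "c \<in> (\<lambda>g. g ` B0) ` G" "q \<in> c" for p b q c
  proof -
    obtain f where f: "f \<in> G" "p = f p0" "b = f ` B0" using base[OF pb] by auto
    obtain h where h: "h \<in> G" "q = h p0" "c = h ` B0" using base[OF qc] by auto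
    obtain f' where f': "f' \<in> G" "\<And>x. x \<in> P \<Longrightarrow> f' (f x) = x"
      using subgroup_BijGroup_inverse[OF G f(1)] by metis
    have fP: "f x \<in> P" if "x \<in> B0" for x
      using subgroup_BijGroup_bij_betw[OF G f(1)] that B0 by (auto dest: bij_betw_apply)
    \<comment> \<open>Going back from the first flag to the base flag by \<open>f'\<close> and on to
      the second by \<open>h\<close> gives the required element.\<close>
    have *: "compose P h f' (f x) = h x" if "x \<in> B0" for x
      using fP[OF that] f'(2) that B0 by (auto simp: compose_def)
    have "compose P h f' p = q" using * p0 f h by simp
    moreover have "compose P h f' ` b = c" using * f h by (simp add: image_image)
    ultimately show ?thesis using subgroup_BijGroup_compose[OF G h(1) f'(1)] by metis
  qed
  then show ?thesis
    unfolding flag_transitive_def flags_def by (simp add: split_beta)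
qed

text \<open>Double counting of the pairs in \<open>R\<close> against the blocks containing both
  points. Transitivity on \<open>R\<close> makes the number of blocks through such a pair constant,
  and every block, being an image of \<open>B0\<close>, holds \<open>card B0 * e\<close> of the
  pairs.\<close>

lemma orbital_block_count:
  fixes R :: "'a \<Rightarrow> 'a \<Rightarrow> bool"
  assumes G: "subgroup G (BijGroup P)" and fin: "finite P" and B0: "B0 \<subseteq> P"
    and inv: "\<And>g p q. g \<in> G \<Longrightarrow> p \<in> P \<Longrightarrow> q \<in> P \<Longrightarrow> R (g p) (g q) \<longleftrightarrow> R p q"
    and tr: "\<And>p q p' q'. \<lbrakk>p \<in> P; q \<in> P; p' \<in> P; q' \<in> P; R p q; R p' q'\<rbrakk> \<Longrightarrow>
      \<exists>g\<in>G. g p = p' \<and> g q = q'"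
    and deg: "\<And>p. p \<in> P \<Longrightarrow> card {q\<in>P. R p q} = d"
    and deg0: "\<And>p. p \<in> B0 \<Longrightarrow> card {q\<in>B0. R p q} = e"
    and pq: "p \<in> P" "q \<in> P" "R p q"
  defines "B \<equiv> (\<lambda>g. g ` B0) ` G"
  shows "card {b \<in> B. {p, q} \<subseteq> b} * (card P * d) = card B * (card B0 * e)"
proof -
  let ?N = "\<lambda>t. {b \<in> B. fst t \<in> b \<and> snd t \<in> b}"
  define T where "T = {t \<in> P \<times> P. R (fst t) (snd t)}"
  have Bsub: "b \<subseteq> P" if "b \<in> B" for b
    using orbit_block_subset[OF G B0] that B_def by blast
  have finB: "finite B"
    by (rule finite_subset[of _ "Pow P"]) (use Bsub fin in auto)
  have finT: "finite T" using fin by (simp add: T_def)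
  have T_Sigma: "T = Sigma P (\<lambda>p. {q\<in>P. R p q})" by (auto simp: T_def)
  have cardT: "card T = card P * d"
    using fin deg by (simp add: T_Sigma)
  \<comment> \<open>An element of \<open>G\<close> taking \<open>t\<close> to \<open>t'\<close>
    injects the blocks through \<open>t\<close> into those through \<open>t'\<close>; exchanging the
    roles gives equality.\<close>
  have le: "card (?N t) \<le> card (?N t')" if t: "t \<in> T" "t' \<in> T" for t t'
  proof -
    obtain g where g: "g \<in> G" "g (fst t) = fst t'" "g (snd t) = snd t'"
      using tr[of "fst t" "snd t" "fst t'" "snd t'"] t by (auto simp: T_def)
    have inj: "inj_on g P" using subgroup_BijGroup_bij_betw[OF G g(1)] bij_betw_def by blast
    show ?thesis
    proof (rule card_inj_on_le[of "\<lambda>b. g ` b"])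
      show "inj_on (\<lambda>b. g ` b) (?N t)"
        by (rule inj_onI) (use Bsub inj in \<open>simp add: inj_on_image_eq_iff\<close>)
      have "g ` b \<in> B" if "b \<in> B" for b
        using orbit_block_image[OF G B0 _ g(1)] that by (simp add: B_def)
      then show "(\<lambda>b. g ` b) ` ?N t \<subseteq> ?N t'"
        using g(2,3) by (auto intro: image_eqI[OF sym])
    qed (use finB in simp)
  qed
  have const: "\<forall>t\<in>T. card (?N t) = card (?N (p, q))"
  proof
    fix t assume t: "t \<in> T"
    have t': "(p, q) \<in> T" using pq by (simp add: T_def)
    show "card (?N t) = card (?N (p, q))" by (rule le_antisym[OF le[OF t t'] le[OF t' t]])
  qed
  have pairs: "card {t\<in>T. fst t \<in> b \<and> snd t \<in> b} = card B0 * e" if b: "b \<in> B" for b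
  proof -
    obtain g where g: "g \<in> G" "b = g ` B0" using b B_def by auto
    have inj: "inj_on g B0"
      using subgroup_BijGroup_bij_betw[OF G g(1)] bij_betw_def inj_on_subset B0 by metis
    \<comment> \<open>Since \<open>R\<close> is invariant, \<open>g\<close> carries the related
      pairs inside \<open>B0\<close> bijectively to those inside \<open>b\<close>.\<close>
    have "{t\<in>T. fst t \<in> b \<and> snd t \<in> b} = map_prod g g ` Sigma B0 (\<lambda>p. {q\<in>B0. R p q})"
    proof -
      have "R (g x) (g y) \<longleftrightarrow> R x y" "g x \<in> P" if "x \<in> B0" "y \<in> B0" for x y
        using inv[OF g(1)] that B0 subgroup_BijGroup_bij_betw[OF G g(1)]
        by (auto dest: bij_betw_apply)
      then show ?thesis unfolding T_def g(2) by (force simp: map_prod_def)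
    qed
    moreover have "inj_on (map_prod g g) (Sigma B0 (\<lambda>p. {q\<in>B0. R p q}))"
      by (rule inj_on_subset[OF map_prod_inj_on[OF inj inj]]) auto
    moreover have "finite B0" using fin B0 finite_subset by blast
    ultimately show ?thesis using deg0 by (simp add: card_image)
  qed
  have "(\<Sum>b\<in>B. card {t\<in>T. fst t \<in> b \<and> snd t \<in> b}) = card (?N (p, q)) * card T"
    by (rule sum_multicount[OF finB finT const])
  then show ?thesis using pairs cardT by simp
qed

text \<open>Inverting an injective homomorphism on its image; closure of \<open>W\<close> ensures
  that a product of two preimages is again the chosen preimage. It turns a faithful action into an
  isomorphism with a permutation group.\<close>

lemma iso_image_carrier:
  assumes hom: "h \<in> hom W H" and inj: "inj_on h (carrier W)"
    and closed: "\<And>x y. x \<in> carrier W \<Longrightarrow> y \<in> carrier W \<Longrightarrow> x \<otimes>\<^bsub>W\<^esub> y \<in> carrier W"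
  shows "H\<lparr>carrier := h ` carrier W\<rparr> \<cong> W"
proof -
  have "inv_into (carrier W) h \<in> iso (H\<lparr>carrier := h ` carrier W\<rparr>) W"
  proof (rule isoI)
    show "bij_betw (inv_into (carrier W) h) (carrier (H\<lparr>carrier := h ` carrier W\<rparr>)) (carrier W)"
      using inj by (simp add: bij_betw_inv_into bij_betw_imageI)
    show "inv_into (carrier W) h \<in> hom (H\<lparr>carrier := h ` carrier W\<rparr>) W"
      by (rule homI)
        (auto simp: inv_into_f_f[OF inj] closed simp flip: hom_mult[OF hom])
  qed
  then show ?thesis unfolding is_iso_def by auto
qed

section \<open>The product action of \<open>Sym(m) \<wr> Sym(2)\<close>\<close>

abbreviation grid :: "nat \<Rightarrow> (nat \<times> nat) set" where
  "grid m \<equiv> {1..m} \<times> {1..m}"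

text \<open>The product action. Coordinates are exchanged first and permuted afterwards, the order
  that fits the multiplication of the semidirect product; \<open>restrict\<close> puts the map into
  \<open>Bij (grid m)\<close>.\<close>

definition wr_act ::
  "nat \<Rightarrow> ((nat \<Rightarrow> nat) \<times> (nat \<Rightarrow> nat)) \<times> (nat \<Rightarrow> nat) \<Rightarrow> nat \<times> nat \<Rightarrow> nat \<times> nat" where
  "wr_act m = (\<lambda>((x, y), s).
     restrict (\<lambda>(i, j). if s = id then (x i, y j) else (x j, y i)) (grid m))"

definition wr_group :: "nat \<Rightarrow> (nat \<times> nat \<Rightarrow> nat \<times> nat) set" where
  "wr_group m = wr_act m ` carrier (sym_wr_sym2 m)"

lemma carrier_sym_wr_sym2:
  "w \<in> carrier (sym_wr_sym2 m) \<longleftrightarrow>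
     fst (fst w) permutes {1..m} \<and> snd (fst w) permutes {1..m} \<and> snd w permutes {1..2}"
  by (auto simp: sym_wr_sym2_def semidirect_prod_def sym_group_def mem_Times_iff)

lemma mult_sym_wr_sym2:
  "((x, y), s) \<otimes>\<^bsub>sym_wr_sym2 m\<^esub> ((x', y'), s') =
     ((if s = id then (x \<circ> x', y \<circ> y') else (x \<circ> y', y \<circ> x')), s \<circ> s')"
  by (simp add: sym_wr_sym2_def semidirect_prod_def sym_group_def)

lemma permutes_2_cases:
  assumes "s permutes {1..2::nat}"
  shows "s = id \<or> s = transpose 1 2"
proof -
  have "s 1 \<in> {1..2}" "s 2 \<in> {1..2}" using assms by (simp_all only: permutes_in_image) auto
  moreover have "s 1 \<noteq> s 2" by (simp add: inj_eq[OF permutes_inj[OF assms]])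
  ultimately have "s 1 = 1 \<and> s 2 = 2 \<or> s 1 = 2 \<and> s 2 = 1" by auto
  moreover have "s z = z" if "z \<noteq> 1" "z \<noteq> 2" for z
    using permutes_not_in[OF assms] that by auto
  ultimately have "(\<forall>z. s z = id z) \<or> (\<forall>z. s z = transpose 1 2 z)"
    unfolding transpose_def by (metis id_apply)
  then show ?thesis by (simp add: fun_eq_iff)
qed

lemma transpose_1_2_neq_id: "transpose 1 (2::nat) \<noteq> id"
proof
  assume "transpose 1 (2::nat) = id"
  from fun_cong[OF this, of 1] show False by simp
qed

lemma wr_act_Bij:
  assumes "w \<in> carrier (sym_wr_sym2 m)"
  shows "wr_act m w \<in> Bij (grid m)"
proof -
  obtain x y s where w: "w = ((x, y), s)" by (metis prod.collapse)
  have xy: "x permutes {1..m}" "y permutes {1..m}"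
    using assms by (auto simp: carrier_sym_wr_sym2 w)
  have into: "wr_act m w ` grid m \<subseteq> grid m"
    by (clarsimp simp: wr_act_def w permutes_in_image[OF xy(1)] permutes_in_image[OF xy(2)]
        simp del: atLeastAtMost_iff split: if_splits)
  have "inj_on (wr_act m w) (grid m)"
    using inj_eq[OF permutes_inj[OF xy(1)]] inj_eq[OF permutes_inj[OF xy(2)]]
    by (auto simp: wr_act_def w inj_on_def)
  then have "bij_betw (wr_act m w) (grid m) (grid m)"
    using into by (intro bij_betw_imageI endo_inj_surj) auto
  then show ?thesis by (auto simp: Bij_def wr_act_def w)
qed

lemma sym_wr_sym2_closed:
  assumes "w \<in> carrier (sym_wr_sym2 m)" "w' \<in> carrier (sym_wr_sym2 m)"
  shows "w \<otimes>\<^bsub>sym_wr_sym2 m\<^esub> w' \<in> carrier (sym_wr_sym2 m)"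
proof -
  obtain x y s x' y' s' where "w = ((x, y), s)" "w' = ((x', y'), s')" by (metis prod.collapse)
  with assms show ?thesis
    by (auto simp: carrier_sym_wr_sym2 mult_sym_wr_sym2 intro: permutes_compose)
qed

text \<open>Moving \<open>(x', y')\<close> past the exchange of coordinates swaps its two
  components, which is the twist in the semidirect product.\<close>

lemma wr_act_mult:
  assumes "w \<in> carrier (sym_wr_sym2 m)" "w' \<in> carrier (sym_wr_sym2 m)"
  shows "wr_act m (w \<otimes>\<^bsub>sym_wr_sym2 m\<^esub> w') = compose (grid m) (wr_act m w) (wr_act m w')"
proof -
  obtain x y s x' y' s' where w: "w = ((x, y), s)" "w' = ((x', y'), s')"
    by (metis prod.collapse)
  have s: "s = id \<or> s = transpose 1 2" "s' = id \<or> s' = transpose 1 2"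
    using assms permutes_2_cases by (auto simp: carrier_sym_wr_sym2 w)
  have p: "x' i \<in> {1..m}" "y' i \<in> {1..m}" if "i \<in> {1..m}" for i
    using assms that by (simp_all only: carrier_sym_wr_sym2 w fst_conv snd_conv permutes_in_image)
  show ?thesis
  proof (rule ext)
    fix z
    show "wr_act m (w \<otimes>\<^bsub>sym_wr_sym2 m\<^esub> w') z = compose (grid m) (wr_act m w) (wr_act m w') z"
    proof (cases "z \<in> grid m")
      case True
      then obtain i j where "z = (i, j)" "i \<in> {1..m}" "j \<in> {1..m}" by auto
      with s p[of i] p[of j] transpose_1_2_neq_id show ?thesis
        by (auto simp: wr_act_def w mult_sym_wr_sym2 compose_def simp del: atLeastAtMost_iff)
    qed (auto simp: wr_act_def w mult_sym_wr_sym2 compose_def)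
  qed
qed

lemma wr_act_hom: "wr_act m \<in> hom (sym_wr_sym2 m) (BijGroup (grid m))"
  by (rule homI) (auto simp: BijGroup_def wr_act_Bij wr_act_mult)

lemma inj_on_wr_act:
  assumes "m \<ge> 2"
  shows "inj_on (wr_act m) (carrier (sym_wr_sym2 m))"
proof (rule inj_onI)
  fix w w'
  assume c: "w \<in> carrier (sym_wr_sym2 m)" "w' \<in> carrier (sym_wr_sym2 m)"
    and eq: "wr_act m w = wr_act m w'"
  obtain x y s x' y' s' where w: "w = ((x, y), s)" "w' = ((x', y'), s')"
    by (metis prod.collapse)
  have xy: "x permutes {1..m}" "y permutes {1..m}" "x' permutes {1..m}" "y' permutes {1..m}"
    using c by (auto simp: carrier_sym_wr_sym2 w)
  have s: "s = id \<or> s = transpose 1 2" "s' = id \<or> s' = transpose 1 2"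
    using c permutes_2_cases by (auto simp: carrier_sym_wr_sym2 w)
  have e: "(if s = id then (x i, y j) else (x j, y i)) =
      (if s' = id then (x' i, y' j) else (x' j, y' i))" if "i \<in> {1..m}" "j \<in> {1..m}" for i j
    using fun_cong[OF eq, of "(i, j)"] that by (simp add: wr_act_def w)
  have neq: "x 1 \<noteq> x 2" "x' 1 \<noteq> x' 2"
    by (simp_all add: inj_eq[OF permutes_inj[OF xy(1)]] inj_eq[OF permutes_inj[OF xy(3)]])
  \<comment> \<open>The points \<open>(1, 1)\<close> and \<open>(1, 2)\<close> have images with the
    same first coordinate exactly when no exchange takes place.\<close>
  have ss: "s = id \<longleftrightarrow> s' = id"
    using e[of 1 1] e[of 1 2] e[of 2 1] neq assms by (auto split: if_splits)
  \<comment> \<open>On the diagonal both forms of the action give \<open>(x i, y i)\<close>.\<close>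
  then have "x i = x' i" "y i = y' i" if "i \<in> {1..m}" for i
    using e[OF that that] by (auto split: if_splits)
  then have "x i = x' i" "y i = y' i" for i
    using xy permutes_not_in by metis+
  then show "w = w'" using s ss by (auto simp: w)
qed

lemma wr_group_iso:
  "m \<ge> 2 \<Longrightarrow> (BijGroup (grid m))\<lparr>carrier := wr_group m\<rparr> \<cong> sym_wr_sym2 m"
  unfolding wr_group_def
  by (rule iso_image_carrier[OF wr_act_hom inj_on_wr_act]) (auto intro: sym_wr_sym2_closed)

lemma wr_group_direct:
  assumes "x permutes {1..m}" "y permutes {1..m}"
  obtains g where "g \<in> wr_group m"
    "\<And>i j. i \<in> {1..m} \<Longrightarrow> j \<in> {1..m} \<Longrightarrow> g (i, j) = (x i, y j)"
proof
  show "wr_act m ((x, y), id) \<in> wr_group m"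
    using assms by (auto simp: wr_group_def carrier_sym_wr_sym2 permutes_id)
qed (simp add: wr_act_def)

lemma wr_group_swap:
  assumes "x permutes {1..m}" "y permutes {1..m}"
  obtains g where "g \<in> wr_group m"
    "\<And>i j. i \<in> {1..m} \<Longrightarrow> j \<in> {1..m} \<Longrightarrow> g (i, j) = (x j, y i)"
proof
  show "wr_act m ((x, y), transpose 1 2) \<in> wr_group m"
    using assms by (auto simp: wr_group_def carrier_sym_wr_sym2 intro!: imageI permutes_swap_id)
qed (use transpose_1_2_neq_id in \<open>simp add: wr_act_def\<close>)

lemma wr_group_cases:
  assumes "g \<in> wr_group m"
  obtains x y where "x permutes {1..m}" "y permutes {1..m}"
    "(\<forall>i\<in>{1..m}. \<forall>j\<in>{1..m}. g (i, j) = (x i, y j)) \<or>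
     (\<forall>i\<in>{1..m}. \<forall>j\<in>{1..m}. g (i, j) = (x j, y i))"
proof -
  obtain x y s where "g = wr_act m ((x, y), s)" "((x, y), s) \<in> carrier (sym_wr_sym2 m)"
    using assms by (auto simp: wr_group_def)
  then show thesis
    by (intro that[of x y]) (auto simp: wr_act_def carrier_sym_wr_sym2)
qed

lemma wr_group_subgroup: "subgroup (wr_group m) (BijGroup (grid m))"
proof (rule group.subgroupI[OF group_BijGroup])
  show "wr_group m \<subseteq> carrier (BijGroup (grid m))"
    using wr_act_Bij by (auto simp: wr_group_def BijGroup_def)
  show "wr_group m \<noteq> {}"
    by (metis wr_group_direct permutes_id empty_iff)
next
  fix a b assume "a \<in> wr_group m" "b \<in> wr_group m"
  then obtain v w where vw: "v \<in> carrier (sym_wr_sym2 m)" "a = wr_act m v"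
    "w \<in> carrier (sym_wr_sym2 m)" "b = wr_act m w" by (auto simp: wr_group_def)
  then show "a \<otimes>\<^bsub>BijGroup (grid m)\<^esub> b \<in> wr_group m"
    using hom_mult[OF wr_act_hom vw(1,3)] sym_wr_sym2_closed[OF vw(1,3)]
    by (metis imageI wr_group_def)
next
  fix a assume "a \<in> wr_group m"
  then obtain x y s where w: "((x, y), s) \<in> carrier (sym_wr_sym2 m)" "a = wr_act m ((x, y), s)"
    by (auto simp: wr_group_def)
  have xy: "x permutes {1..m}" "y permutes {1..m}" and s: "s permutes {1..2}"
    using w by (auto simp: carrier_sym_wr_sym2)
  \<comment> \<open>The inverse in the wreath product: \<open>s\<close> is its own inverse, and
    conjugation by a nontrivial \<open>s\<close> exchanges the inverted components.\<close>
  define w' where "w' = ((if s = id then (inv' x, inv' y) else (inv' y, inv' x)), s)"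
  have w': "w' \<in> carrier (sym_wr_sym2 m)"
    using xy s by (auto simp: w'_def carrier_sym_wr_sym2 intro: permutes_inv)
  have "s \<circ> s = id" using permutes_2_cases[OF s] by auto
  then have "w' \<otimes>\<^bsub>sym_wr_sym2 m\<^esub> ((x, y), s) = ((id, id), id)"
    using permutes_inv_o[OF xy(1)] permutes_inv_o[OF xy(2)]
    by (auto simp: w'_def mult_sym_wr_sym2)
  moreover have "wr_act m ((id, id), id) = \<one>\<^bsub>BijGroup (grid m)\<^esub>"
    by (auto simp: BijGroup_def wr_act_def restrict_def)
  ultimately have "wr_act m w' \<otimes>\<^bsub>BijGroup (grid m)\<^esub> a = \<one>\<^bsub>BijGroup (grid m)\<^esub>"
    using hom_mult[OF wr_act_hom w' w(1)] w(2) by simp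
  then have "inv\<^bsub>BijGroup (grid m)\<^esub> a = wr_act m w'"
    using wr_act_Bij[OF w(1)] wr_act_Bij[OF w'] w(2)
    by (intro group.inv_equality[OF group_BijGroup]) (auto simp: BijGroup_def)
  then show "inv\<^bsub>BijGroup (grid m)\<^esub> a \<in> wr_group m"
    using w' by (simp add: wr_group_def)
qed


section \<open>The two orbits on pairs of distinct points\<close>

text \<open>Adjacency in the rook's graph, that is, distinct edges of the complete bipartite graph
  sharing an end; \<open>skew\<close> is disjointness of edges.\<close>

definition collinear :: "nat \<times> nat \<Rightarrow> nat \<times> nat \<Rightarrow> bool" where
  "collinear p q \<longleftrightarrow> p \<noteq> q \<and> (fst p = fst q \<or> snd p = snd q)"

definition skew :: "nat \<times> nat \<Rightarrow> nat \<times> nat \<Rightarrow> bool" where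
  "skew p q \<longleftrightarrow> fst p \<noteq> fst q \<and> snd p \<noteq> snd q"

lemma collinear_or_skew: "p \<noteq> q \<Longrightarrow> collinear p q \<or> skew p q"
  by (auto simp: collinear_def skew_def prod_eq_iff)

lemma wr_group_collinear_iff:
  assumes "g \<in> wr_group m" "p \<in> grid m" "q \<in> grid m"
  shows "collinear (g p) (g q) \<longleftrightarrow> collinear p q"
proof -
  obtain x y where xy: "x permutes {1..m}" "y permutes {1..m}"
    "(\<forall>i\<in>{1..m}. \<forall>j\<in>{1..m}. g (i, j) = (x i, y j)) \<or>
     (\<forall>i\<in>{1..m}. \<forall>j\<in>{1..m}. g (i, j) = (x j, y i))"
    by (rule wr_group_cases[OF assms(1)])
  show ?thesis
    using xy(3) assms(2,3) inj_eq[OF permutes_inj[OF xy(1)]] inj_eq[OF permutes_inj[OF xy(2)]]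
    by (cases p; cases q) (auto simp: collinear_def)
qed

lemma wr_group_skew_iff:
  assumes "g \<in> wr_group m" "p \<in> grid m" "q \<in> grid m"
  shows "skew (g p) (g q) \<longleftrightarrow> skew p q"
proof -
  obtain x y where xy: "x permutes {1..m}" "y permutes {1..m}"
    "(\<forall>i\<in>{1..m}. \<forall>j\<in>{1..m}. g (i, j) = (x i, y j)) \<or>
     (\<forall>i\<in>{1..m}. \<forall>j\<in>{1..m}. g (i, j) = (x j, y i))"
    by (rule wr_group_cases[OF assms(1)])
  show ?thesis
    using xy(3) assms(2,3) inj_eq[OF permutes_inj[OF xy(1)]] inj_eq[OF permutes_inj[OF xy(2)]]
    by (cases p; cases q) (auto simp: skew_def)
qed

text \<open>The first transposition sends \<open>i\<close> to \<open>k\<close>; the second corrects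
  the image of \<open>i'\<close> and leaves \<open>k\<close> fixed, by the assumed
  equivalence.\<close>

lemma ex_permutes_two_points:
  assumes "i \<in> S" "i' \<in> S" "k \<in> S" "k' \<in> S" "i = i' \<longleftrightarrow> k = k'"
  obtains x where "x permutes S" "x i = k" "x i' = k'"
proof
  let ?a = "transpose i k" and ?b = "transpose k' (transpose i k i')"
  have "transpose i k i' \<in> S" using assms by (auto simp: transpose_def)
  then show "(?b \<circ> ?a) permutes S"
    using assms by (intro permutes_compose permutes_swap_id)
  show "(?b \<circ> ?a) i = k" "(?b \<circ> ?a) i' = k'"
    using assms(5) by (auto simp: transpose_def)
qed

text \<open>A collinear pair agrees in exactly one coordinate. If both pairs agree in the same one,
  permuting the coordinates separately suffices; otherwise the coordinates must be
  exchanged.\<close>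

lemma wr_group_transitive_collinear:
  assumes "p \<in> grid m" "q \<in> grid m" "p' \<in> grid m" "q' \<in> grid m"
    and c: "collinear p q" "collinear p' q'"
  shows "\<exists>g\<in>wr_group m. g p = p' \<and> g q = q'"
proof -
  obtain a b c d a' b' c' d' where pq: "p = (a, b)" "q = (c, d)" "p' = (a', b')" "q' = (c', d')"
    by (metis prod.collapse)
  have mem: "a \<in> {1..m}" "b \<in> {1..m}" "c \<in> {1..m}" "d \<in> {1..m}"
    "a' \<in> {1..m}" "b' \<in> {1..m}" "c' \<in> {1..m}" "d' \<in> {1..m}"
    using assms by (auto simp: pq)
  show ?thesis
  proof (cases "a = c \<longleftrightarrow> a' = c'")
    case True
    then have "b = d \<longleftrightarrow> b' = d'" using c by (auto simp: collinear_def pq)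
    with True mem obtain x y where "x permutes {1..m}" "x a = a'" "x c = c'"
      "y permutes {1..m}" "y b = b'" "y d = d'"
      using ex_permutes_two_points by metis
    with mem show ?thesis
      by (metis pq wr_group_direct)
  next
    case False
    then have "b = d \<longleftrightarrow> a' = c'" "a = c \<longleftrightarrow> b' = d'"
      using c by (auto simp: collinear_def pq)
    with mem obtain x y where "x permutes {1..m}" "x b = a'" "x d = c'"
      "y permutes {1..m}" "y a = b'" "y c = d'"
      using ex_permutes_two_points by metis
    with mem show ?thesis
      by (metis pq wr_group_swap)
  qed
qed

lemma wr_group_transitive_skew:
  assumes "p \<in> grid m" "q \<in> grid m" "p' \<in> grid m" "q' \<in> grid m"
    and s: "skew p q" "skew p' q'"
  shows "\<exists>g\<in>wr_group m. g p = p' \<and> g q = q'"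
proof -
  obtain a b c d a' b' c' d' where pq: "p = (a, b)" "q = (c, d)" "p' = (a', b')" "q' = (c', d')"
    by (metis prod.collapse)
  have mem: "a \<in> {1..m}" "b \<in> {1..m}" "c \<in> {1..m}" "d \<in> {1..m}"
    "a' \<in> {1..m}" "b' \<in> {1..m}" "c' \<in> {1..m}" "d' \<in> {1..m}"
    using assms by (auto simp: pq)
  have "a = c \<longleftrightarrow> a' = c'" "b = d \<longleftrightarrow> b' = d'" using s by (auto simp: skew_def pq)
  with mem obtain x y where "x permutes {1..m}" "x a = a'" "x c = c'"
    "y permutes {1..m}" "y b = b'" "y d = d'"
    using ex_permutes_two_points by metis
  with mem show ?thesis
    by (metis pq wr_group_direct)
qed

lemma wr_group_transitive_on: "transitive_on (wr_group m) (grid m)"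
  unfolding transitive_on_def
proof (intro ballI)
  fix p q assume "p \<in> grid m" "q \<in> grid m"
  then obtain a b a' b' where pq: "p = (a, b)" "q = (a', b')"
    and mem: "a \<in> {1..m}" "b \<in> {1..m}" "a' \<in> {1..m}" "b' \<in> {1..m}"
    by (metis mem_Sigma_iff prod.collapse)
  obtain g where g: "g \<in> wr_group m"
    "\<And>i j. i \<in> {1..m} \<Longrightarrow> j \<in> {1..m} \<Longrightarrow> g (i, j) = (transpose a a' i, transpose b b' j)"
    using wr_group_direct[OF permutes_swap_id[OF mem(1,3)] permutes_swap_id[OF mem(2,4)]] by blast
  show "\<exists>g\<in>wr_group m. g p = q"
    by (rule bexI[OF _ g(1)]) (simp add: pq g(2)[OF mem(1,2)])
qed

section \<open>Primitivity of the product action\<close>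

lemma ex_third_index:
  assumes "m \<ge> 3"
  obtains e where "e \<in> {1..m}" "e \<noteq> a" "e \<noteq> (b::nat)"
proof -
  have "card {a, b} < card {1..m}" using assms by (simp add: card_insert_if)
  then have "\<not> {1..m} \<subseteq> {a, b}" using card_mono[of "{a, b}" "{1..m}"] by auto
  then show thesis using that by blast
qed

text \<open>An invariant partition is an invariant equivalence relation. If some class has two
  points, the relation contains all collinear or all skew pairs, and either kind joins any two
  distinct points in at most two steps.\<close>

lemma wr_group_primitive_on:
  assumes m: "m \<ge> 3"
  shows "primitive_on (wr_group m) (grid m)"
proof -
  have main: "Q = {grid m} \<or> Q = (\<lambda>x. {x}) ` grid m"
    if Q: "partition_on (grid m) Q" and inv: "\<And>g D. g \<in> wr_group m \<Longrightarrow> D \<in> Q \<Longrightarrow> g ` D \<in> Q" for Q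
  proof (cases "\<exists>D\<in>Q. \<exists>p\<in>D. \<exists>q\<in>D. p \<noteq> q")
    case True
    define R where "R = (\<lambda>p q. \<exists>D\<in>Q. p \<in> D \<and> q \<in> D)"
    have sub: "D \<subseteq> grid m" if "D \<in> Q" for D using Q that by (auto simp: partition_on_def)
    have R_trans: "R p r" if "R p q" "R q r" for p q r
      using that Q unfolding R_def partition_on_def disjoint_def by blast
    have R_inv: "R (g p) (g q)" if "g \<in> wr_group m" "R p q" for g p q
      using that inv unfolding R_def by blast
    have ex_R: "\<exists>p\<in>grid m. \<exists>q\<in>grid m. p \<noteq> q \<and> R p q"
      using True sub unfolding R_def by blast
    have coll: "R p q" if "collinear p0 q0" "R p0 q0" "p0 \<in> grid m" "q0 \<in> grid m"
        "p \<in> grid m" "q \<in> grid m" "collinear p q" for p0 q0 p q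
      using wr_group_transitive_collinear[of p0 m q0 p q] R_inv that by metis
    have skw: "R p q" if "skew p0 q0" "R p0 q0" "p0 \<in> grid m" "q0 \<in> grid m"
        "p \<in> grid m" "q \<in> grid m" "skew p q" for p0 q0 p q
      using wr_group_transitive_skew[of p0 m q0 p q] R_inv that by metis
    obtain p0 q0 where pq0: "p0 \<in> grid m" "q0 \<in> grid m" "p0 \<noteq> q0" "R p0 q0"
      using ex_R by blast
    have all: "R p q" if pq: "p \<in> grid m" "q \<in> grid m" "p \<noteq> q" for p q
    proof -
      obtain a b c d where ab: "p = (a, b)" "q = (c, d)" by (metis prod.collapse)
      show ?thesis
      proof (cases "collinear p0 q0")
        case True
        note R = coll[OF True pq0(4,1,2)]
        show ?thesis
        proof (cases "collinear p q")
          case False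
          then have "skew p q" using collinear_or_skew pq by blast
          \<comment> \<open>A corner of the rectangle spanned by \<open>p\<close> and
            \<open>q\<close> is collinear with both.\<close>
          then have "collinear p (a, d)" "collinear (a, d) q" and ad: "(a, d) \<in> grid m"
            using pq by (auto simp: ab collinear_def skew_def)
          then have "R p (a, d)" "R (a, d) q" using R[OF pq(1) ad] R[OF ad pq(2)] by simp_all
          then show ?thesis by (rule R_trans)
        qed (rule R[OF pq(1,2)])
      next
        case False
        then have "skew p0 q0" using collinear_or_skew pq0 by blast
        note R = skw[OF this pq0(4,1,2)]
        show ?thesis
        proof (cases "skew p q")
          case False
          \<comment> \<open>Collinear \<open>p\<close> and \<open>q\<close> are joined through a
            point skew to both; \<open>m \<ge> 3\<close> leaves room to avoid two values in each
            coordinate.\<close>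
          obtain e where e: "e \<in> {1..m}" "e \<noteq> a" "e \<noteq> c" using ex_third_index[OF m] .
          obtain f where f: "f \<in> {1..m}" "f \<noteq> b" "f \<noteq> d" using ex_third_index[OF m] .
          have "skew p (e, f)" "skew (e, f) q" and ef: "(e, f) \<in> grid m"
            using e f by (auto simp: ab skew_def)
          then have "R p (e, f)" "R (e, f) q" using R[OF pq(1) ef] R[OF ef pq(2)] by simp_all
          then show ?thesis by (rule R_trans)
        qed (rule R[OF pq(1,2)])
      qed
    qed
    obtain D where D: "D \<in> Q" "p0 \<in> D" using pq0 unfolding R_def by blast
    have uniq: "E = D" if "E \<in> Q" "p0 \<in> E" for E
      using Q D that unfolding partition_on_def disjoint_def by blast
    have "grid m \<subseteq> D"
    proof
      fix q assume "q \<in> grid m"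
      then show "q \<in> D" using all[of p0 q] pq0(1) D uniq unfolding R_def by metis
    qed
    then have DP: "D = grid m" using sub D by blast
    have "E = D" if "E \<in> Q" for E
    proof -
      have "E \<noteq> {}" "E \<subseteq> D" using Q that sub DP by (auto simp: partition_on_def)
      then show ?thesis using Q D that unfolding partition_on_def disjoint_def by blast
    qed
    then have "Q = {D}" using D(1) by blast
    then show ?thesis using DP by blast
  next
    case False
    have "D \<in> (\<lambda>x. {x}) ` grid m" if D: "D \<in> Q" for D
    proof -
      have "D \<noteq> {}" using Q D by (auto simp: partition_on_def)
      then obtain x where "x \<in> D" by blast
      moreover from this have "D = {x}" using False D by blast
      moreover have "D \<subseteq> grid m" using Q D by (auto simp: partition_on_def)
      ultimately show ?thesis by blast
    qed
    moreover have "{x} \<in> Q" if x: "x \<in> grid m" for x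
    proof -
      obtain D where D: "D \<in> Q" "x \<in> D" using Q x unfolding partition_on_def by blast
      then have "D = {x}" using False by blast
      with D show ?thesis by simp
    qed
    ultimately have "Q = (\<lambda>x. {x}) ` grid m" by blast
    then show ?thesis ..
  qed
  show ?thesis
    unfolding primitive_on_def
  proof (intro conjI allI impI wr_group_transitive_on)
    fix Q
    assume "partition_on (grid m) Q \<and> (\<forall>g\<in>wr_group m. \<forall>D\<in>Q. g ` D \<in> Q)"
    then show "Q = {grid m} \<or> Q = (\<lambda>x. {x}) ` grid m"
      by (intro main) simp_all
  qed
qed

section \<open>Numbers of collinear and skew points in the grid\<close>

lemma card_collinear:
  assumes "p \<in> grid m"
  shows "card {q \<in> grid m. collinear p q} = 2 * (m - 1)"
proof -
  obtain a b where p: "p = (a, b)" "a \<in> {1..m}" "b \<in> {1..m}" using assms by auto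
  have "{q \<in> grid m. collinear p q} = {a} \<times> ({1..m} - {b}) \<union> ({1..m} - {a}) \<times> {b}"
    using p by (auto simp: collinear_def)
  moreover have "card ({a} \<times> ({1..m} - {b}) \<union> ({1..m} - {a}) \<times> {b}) =
      card ({a} \<times> ({1..m} - {b})) + card (({1..m} - {a}) \<times> {b})"
    by (rule card_Un_disjoint) auto
  ultimately show ?thesis using p by (simp add: card_cartesian_product card_Diff_singleton)
qed

lemma card_skew:
  assumes "p \<in> grid m"
  shows "card {q \<in> grid m. skew p q} = (m - 1)\<^sup>2"
proof -
  obtain a b where p: "p = (a, b)" "a \<in> {1..m}" "b \<in> {1..m}" using assms by auto
  have "{q \<in> grid m. skew p q} = ({1..m} - {a}) \<times> ({1..m} - {b})"
    using p by (auto simp: skew_def)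
  then show ?thesis
    using p by (simp add: card_cartesian_product card_Diff_singleton power2_eq_square)
qed

section \<open>The base block\<close>

text \<open>The cyclic permutation \<open>(1 2 ... n)\<close>, fixing everything else, so that it
  also permutes \<open>{1..m}\<close> for \<open>n \<le> m\<close>.\<close>

definition cyc :: "nat \<Rightarrow> nat \<Rightarrow> nat" where
  "cyc n i = (if i \<in> {1..<n} then i + 1 else if i = n then 1 else i)"

text \<open>For \<open>n \<ge> 2\<close>, the edges of a cycle of length \<open>2 * n\<close>: the
  left vertex \<open>i\<close> is joined to the right vertices \<open>i\<close> and
  \<open>cyc n i\<close>.\<close>

definition cycle_block :: "nat \<Rightarrow> (nat \<times> nat) set" where
  "cycle_block n = (\<lambda>i. (i, i)) ` {1..n} \<union> (\<lambda>i. (i, cyc n i)) ` {1..n}"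

lemma cyc_permutes: "n \<ge> 1 \<Longrightarrow> cyc n permutes {1..n}"
proof (rule bij_imp_permutes)
  assume n: "n \<ge> 1"
  have "inj_on (cyc n) {1..n}" by (auto simp: inj_on_def cyc_def split: if_splits)
  moreover have "cyc n ` {1..n} \<subseteq> {1..n}" using n by (auto simp: cyc_def)
  ultimately show "bij_betw (cyc n) {1..n} {1..n}"
    by (intro bij_betw_imageI endo_inj_surj) auto
qed (auto simp: cyc_def)

lemma cyc_neq: "n \<ge> 2 \<Longrightarrow> i \<in> {1..n} \<Longrightarrow> cyc n i \<noteq> i"
  by (auto simp: cyc_def)

lemma cyc_eq_iff: "n \<ge> 1 \<Longrightarrow> cyc n i = cyc n j \<longleftrightarrow> i = j"
  by (rule inj_eq[OF permutes_inj[OF cyc_permutes]])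

lemma cyc_in: "n \<ge> 1 \<Longrightarrow> cyc n i \<in> {1..n} \<longleftrightarrow> i \<in> {1..n}"
  by (rule permutes_in_image[OF cyc_permutes])

lemma finite_cycle_block: "finite (cycle_block n)"
  by (simp add: cycle_block_def)

lemma cycle_block_subset: "1 \<le> n \<Longrightarrow> n \<le> m \<Longrightarrow> cycle_block n \<subseteq> grid m"
  by (auto simp: cycle_block_def cyc_def)

lemma card_cycle_block:
  assumes "n \<ge> 2"
  shows "card (cycle_block n) = 2 * n"
proof -
  have "card (cycle_block n) =
      card ((\<lambda>i. (i, i)) ` {1..n}) + card ((\<lambda>i. (i, cyc n i)) ` {1..n})"
    unfolding cycle_block_def
    by (rule card_Un_disjoint) (auto simp: cyc_neq[OF assms, THEN not_sym])
  then show ?thesis by (simp add: card_image inj_on_def)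
qed

text \<open>The two collinear points are the edges before and after \<open>p\<close> on the cycle,
  one through each end of \<open>p\<close>.\<close>

lemma card_collinear_cycle_block:
  assumes n: "n \<ge> 2" and p: "p \<in> cycle_block n"
  shows "card {q \<in> cycle_block n. collinear p q} = 2"
proof -
  have n1: "n \<ge> 1" using n by simp
  note [simp] = cyc_eq_iff[OF n1]
  consider i where "p = (i, i)" "i \<in> {1..n}" | i where "p = (i, cyc n i)" "i \<in> {1..n}"
    using p by (auto simp: cycle_block_def)
  then show ?thesis
  proof cases
    case 1
    \<comment> \<open>The cyclic predecessor of \<open>i\<close>, whose second edge ends at the
      right vertex \<open>i\<close>.\<close>
    obtain i' where i': "i' \<in> {1..n}" "cyc n i' = i"
      using permutes_image[OF cyc_permutes[OF n1]] 1(2) by (metis imageE)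
    have neq: "i \<noteq> i'" "cyc n i \<noteq> i" using cyc_neq[OF n i'(1)] cyc_neq[OF n 1(2)] i' by auto
    have "{q \<in> cycle_block n. collinear p q} = {(i, cyc n i), (i', i)}"
    proof (intro equalityI subsetI)
      fix q assume "q \<in> {(i, cyc n i), (i', i)}"
      then show "q \<in> {q \<in> cycle_block n. collinear p q}"
        using 1 i' neq by (auto simp: cycle_block_def collinear_def image_iff)
    next
      fix q assume "q \<in> {q \<in> cycle_block n. collinear p q}"
      then show "q \<in> {(i, cyc n i), (i', i)}"
        using 1(1) i'(2)[symmetric] by (auto simp: cycle_block_def collinear_def)
    qed
    then show ?thesis using neq by simp
  next
    case 2
    have neq: "cyc n i \<noteq> i" using cyc_neq[OF n 2(2)] .
    have "{q \<in> cycle_block n. collinear p q} = {(i, i), (cyc n i, cyc n i)}"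
    proof (intro equalityI subsetI)
      fix q assume "q \<in> {(i, i), (cyc n i, cyc n i)}"
      then show "q \<in> {q \<in> cycle_block n. collinear p q}"
        using 2 neq cyc_in[OF n1, of i] by (auto simp: cycle_block_def collinear_def)
    next
      fix q assume "q \<in> {q \<in> cycle_block n. collinear p q}"
      then show "q \<in> {(i, i), (cyc n i, cyc n i)}"
        using 2(1) by (auto simp: cycle_block_def collinear_def)
    qed
    then show ?thesis using neq by simp
  qed
qed

text \<open>Of the \<open>2 * n\<close> points, \<open>p\<close> and its two collinear ones drop
  out.\<close>

lemma card_skew_cycle_block:
  assumes n: "n \<ge> 2" and p: "p \<in> cycle_block n"
  shows "card {q \<in> cycle_block n. skew p q} = 2 * n - 3"
proof -
  let ?C = "{q \<in> cycle_block n. collinear p q}"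
  have "{q \<in> cycle_block n. skew p q} = cycle_block n - insert p ?C"
    using p by (auto simp: skew_def collinear_def)
  moreover have "card (insert p ?C) = 3"
    using card_collinear_cycle_block[OF assms] finite_cycle_block by (simp add: collinear_def)
  moreover have "insert p ?C \<subseteq> cycle_block n" using p by auto
  ultimately show ?thesis
    using card_cycle_block[OF n] finite_cycle_block
    by (simp add: card_Diff_subset finite_subset)
qed

text \<open>The map \<open>(i, j) \<mapsto> (j, cyc n i)\<close> rotates the cycle by one edge.\<close>

lemma cycle_block_transitive:
  assumes n: "1 \<le> n" "n \<le> m" and q: "q \<in> cycle_block n"
  shows "\<exists>g\<in>wr_group m. g (1, 1) = q \<and> g ` cycle_block n = cycle_block n"
proof -
  let ?good = "\<lambda>q. \<exists>g\<in>wr_group m. g (1, 1) = q \<and> g ` cycle_block n = cycle_block n"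
  have sub: "cycle_block n \<subseteq> grid m" by (rule cycle_block_subset[OF n])
  have "cyc n permutes {1..m}"
    by (rule permutes_subset[OF cyc_permutes]) (use n in auto)
  then obtain t where t: "t \<in> wr_group m"
    "\<And>i j. i \<in> {1..m} \<Longrightarrow> j \<in> {1..m} \<Longrightarrow> t (i, j) = (j, cyc n i)"
    using wr_group_swap[OF permutes_id] by (metis id_apply)
  \<comment> \<open>\<open>t\<close> alternates between the two kinds of edges of the cycle.\<close>
  have t1: "t (i, i) = (i, cyc n i)" "t (i, cyc n i) = (cyc n i, cyc n i)" if "i \<in> {1..n}" for i
    using that n t(2)[of i i] t(2)[of i "cyc n i"] cyc_in[OF n(1), of i] by auto
  have "t ` cycle_block n =
      (\<lambda>i. (i, cyc n i)) ` {1..n} \<union> (\<lambda>i. (cyc n i, cyc n i)) ` {1..n}"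
    unfolding cycle_block_def image_Un image_image using t1 by simp
  also have "(\<lambda>i. (cyc n i, cyc n i)) ` {1..n} = (\<lambda>i. (i, i)) ` cyc n ` {1..n}"
    by (simp add: image_image)
  also have "cyc n ` {1..n} = {1..n}"
    by (rule permutes_image[OF cyc_permutes[OF n(1)]])
  finally have t_block: "t ` cycle_block n = cycle_block n"
    by (simp add: cycle_block_def Un_commute)
  have rotate: "?good (t q)" if "?good q" for q
  proof -
    obtain g where g: "g \<in> wr_group m" "g (1, 1) = q" "g ` cycle_block n = cycle_block n"
      using \<open>?good q\<close> by blast
    have "compose (grid m) t g (1, 1) = t q" using g n by (simp add: compose_def)
    moreover have "compose (grid m) t g ` cycle_block n = cycle_block n"
      by (simp add: compose_image[OF sub] g t_block)
    ultimately show ?thesis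
      using subgroup_BijGroup_compose[OF wr_group_subgroup t(1) g(1)] by blast
  qed
  \<comment> \<open>Two rotations lead from \<open>(i, i)\<close> to the next diagonal point while
    \<open>i < n\<close>; one further rotation then reaches \<open>(i, cyc n i)\<close>.\<close>
  have diag: "?good (i, i)" if "1 \<le> i" "i \<le> n" for i
    using that
  proof (induction i rule: dec_induct)
    case base
    obtain g where g: "g \<in> wr_group m"
      "\<And>i j. i \<in> {1..m} \<Longrightarrow> j \<in> {1..m} \<Longrightarrow> g (i, j) = (i, j)"
      using wr_group_direct[OF permutes_id permutes_id] by (metis id_apply)
    have "g p = p" if "p \<in> grid m" for p using that g(2) by auto
    then have "g ` cycle_block n = (\<lambda>p. p) ` cycle_block n"
      using sub by (intro image_cong) auto
    moreover have "g (1, 1) = (1, 1)" by (rule g(2)) (use n in auto)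
    ultimately show ?case using g(1) by auto
  next
    case (step i)
    have "?good (t (t (i, i)))" by (intro rotate step.IH) (use step in simp)
    moreover have "t (t (i, i)) = (Suc i, Suc i)"
      using step t1[of i] by (simp add: cyc_def)
    ultimately show ?case by simp
  qed
  have "?good (i, cyc n i)" if "i \<in> {1..n}" for i
    using rotate[OF diag, of i] t1(1)[OF that] that by simp
  then show ?thesis using q diag by (auto simp: cycle_block_def)
qed

section \<open>Assembling the design\<close>

theorem corollary4p6:
  fixes m :: nat
  assumes "even m" and "m \<ge> 4"
  shows "\<exists>(P :: (nat \<times> nat) set) B l G.
    two_design P B (m\<^sup>2) (m + 2) l \<and>
    automorphism_group_of G P B \<and>
    (BijGroup P)\<lparr>carrier := G\<rparr> \<cong> sym_wr_sym2 m \<and>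
    flag_transitive G B \<and>
    primitive_on G P"
proof -
  \<comment> \<open>Chosen so that the cycle has \<open>m + 2\<close> edges, which needs
    \<open>m\<close> even.\<close>
  define n where "n = m div 2 + 1"
  have n: "2 * n = m + 2" using assms(1) by (auto simp: n_def)
  then have n': "2 \<le> n" "1 \<le> n" "n \<le> m" using assms(2) by auto
  let ?P = "grid m" and ?G = "wr_group m" and ?C = "cycle_block n"
  let ?B = "(\<lambda>g. g ` ?C) ` ?G"
  let ?N = "\<lambda>S. card {b \<in> ?B. S \<subseteq> b}"
  note G = wr_group_subgroup[of m]
  have B0: "?C \<subseteq> ?P" by (rule cycle_block_subset[OF n'(2,3)])
  have cardB0: "card ?C = m + 2" using card_cycle_block[OF n'(1)] n by simp
  have cardP: "card ?P = m\<^sup>2" by (simp add: power2_eq_square)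
  have N_coll: "?N {p, q} * (m\<^sup>2 * (m - 1)) = card ?B * (m + 2)"
    if "p \<in> ?P" "q \<in> ?P" "collinear p q" for p q
  proof -
    have "?N {p, q} * (card ?P * (2 * (m - 1))) = card ?B * (card ?C * 2)"
      by (rule orbital_block_count[where R = collinear, OF G _ B0])
        (use that wr_group_collinear_iff wr_group_transitive_collinear card_collinear
          card_collinear_cycle_block[OF n'(1)] in auto)
    then show ?thesis by (simp add: cardB0 cardP)
  qed
  \<comment> \<open>Because \<open>2 * n - 3 = m - 1\<close>, a factor \<open>m - 1\<close> cancels
    from the count for skew pairs, leaving the equation for collinear pairs; this is the balance
    that makes a 2-design.\<close>
  have N_skew: "?N {p, q} * (m\<^sup>2 * (m - 1)) = card ?B * (m + 2)"
    if "p \<in> ?P" "q \<in> ?P" "skew p q" for p q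
  proof -
    have "?N {p, q} * (card ?P * (m - 1)\<^sup>2) = card ?B * (card ?C * (2 * n - 3))"
      by (rule orbital_block_count[where R = skew, OF G _ B0])
        (use that wr_group_skew_iff wr_group_transitive_skew card_skew
          card_skew_cycle_block[OF n'(1)] in auto)
    moreover have "2 * n - 3 = m - 1" using n by simp
    ultimately have "(?N {p, q} * (m\<^sup>2 * (m - 1))) * (m - 1) = (card ?B * (m + 2)) * (m - 1)"
      by (simp only: cardB0 cardP power2_eq_square ac_simps)
    then show ?thesis using assms(2) by simp
  qed
  \<comment> \<open>The value at one collinear pair; by the common equation it is the value at every
    pair.\<close>
  define l where "l = ?N {(1, 1), (1, 2)}"
  have l_eq: "l * (m\<^sup>2 * (m - 1)) = card ?B * (m + 2)"
    unfolding l_def using assms(2) by (intro N_coll) (auto simp: collinear_def)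
  have N_eq: "?N S = l" if S: "S \<subseteq> ?P" "card S = 2" for S
  proof -
    obtain p q where pq: "S = {p, q}" "p \<noteq> q" using S(2) by (auto simp: card_2_iff)
    then have "?N S * (m\<^sup>2 * (m - 1)) = card ?B * (m + 2)"
      using S(1) N_coll[of p q] N_skew[of p q] collinear_or_skew[OF pq(2)] by auto
    then have "?N S * (m\<^sup>2 * (m - 1)) = l * (m\<^sup>2 * (m - 1))" using l_eq by simp
    then show ?thesis using assms(2) by simp
  qed
  have finB: "finite ?B"
    by (rule finite_subset[of _ "Pow ?P"]) (use orbit_block_subset[OF G B0] in auto)
  have "?G \<noteq> {}" using subgroup.one_closed[OF G] by blast
  then have "card ?B > 0" using finB by (simp add: card_gt_0_iff)
  \<comment> \<open>With \<open>l = 0\<close> the right side of \<open>l_eq\<close> would vanish,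
    although there are blocks.\<close>
  then have l_pos: "l > 0" using l_eq by (cases "l = 0") auto
  have "card b = m + 2" if b: "b \<in> ?B" for b
  proof -
    obtain g where g: "g \<in> ?G" "b = g ` ?C" using b by auto
    have "inj_on g ?C"
      using subgroup_BijGroup_bij_betw[OF G g(1)] B0 by (meson bij_betw_def inj_on_subset)
    then show ?thesis by (simp add: g card_image cardB0)
  qed
  then have "two_design ?P ?B (m\<^sup>2) (m + 2) l"
    unfolding two_design_def
    using l_pos N_eq cardP orbit_block_subset[OF G B0] assms(2) by auto
  moreover have "automorphism_group_of ?G ?P ?B"
    by (rule automorphism_group_of_block_orbit[OF G B0])
  moreover have "(BijGroup ?P)\<lparr>carrier := ?G\<rparr> \<cong> sym_wr_sym2 m"
    by (rule wr_group_iso) (use assms(2) in simp)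
  moreover have "flag_transitive ?G ?B"
    by (rule flag_transitive_block_orbit[OF G B0, of "(1, 1)"])
      (use cycle_block_transitive[OF n'(2,3)] n' in \<open>auto simp: cycle_block_def\<close>)
  moreover have "primitive_on ?G ?P"
    by (rule wr_group_primitive_on) (use assms(2) in simp)
  ultimately show ?thesis by blast
qed

end
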